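(* Let $m,n\ge 1$ be integers, let $k>0$, and let $\mathcal{G}$ be a weighted digraph on the node set $\{1,\dots,m\}$ with weighted adjacency matrix $A=(a_{ij})\in\mathbf{R}^{m\times m}$. Consider the high-dimensional Kuramoto model with identical oscillators on the unit sphere of $\mathbf{R}^n$, $$\dot r_i = k\sum_{j=1}^m a_{ij}\bigl(r_j-(r_i^{T}r_j)\,r_i\bigr),\qquad i=1,2,\dots,m,\quad \|r_i(t)\|=1,$$ with error matrix $E(t)=(e_{ij}(t))\in\mathbf{R}^{m\times m}$, $e_{ij}=1-r_i^{T}r_j$. If $\mathcal{G}$ has a spanning tree, then exponential synchronization is locally achieved, i.e. there exist a total error function $V(E)=\frac12\beta^{T}E\beta$, with $\beta\in\mathbf{R}^m$ a vector with positive entries, a neighborhood $U$ of $E=0$ in $\mathbf{R}^{m\times m}$, and a constant $c>0$ such that, along every solution of the model on the unit sphere, $$\dot V(E)=\frac{d}{dt}V(E(t))\le -c\,V(E(t))\qquad\text{whenever } E(t)\in U.$$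
   Context: The weighted digraph $\mathcal{G}=(\mathcal{V},\mathcal{E},A)$ has nodes $\mathcal{V}=\{1,\dots,m\}$, edge set $\mathcal{E}\subset\mathcal{V}\times\mathcal{V}$, and weighted adjacency matrix $A=(a_{ij})$ with $a_{ij}>0$ if $(j,i)\in\mathcal{E}$ and $a_{ij}=0$ otherwise. $\mathcal{G}$ has a (directed) spanning tree if and only if it has a root node, i.e. a node $v_0$ such that for any other node $i$ there is a directed path from $v_0$ to $i$, where a directed path from $k_1$ to $k_s$ is a sequence of edges $(k_1,k_2),\dots,(k_{s-1},k_s)$. All states $r_i$ are unit vectors (the dynamics preserves the unit sphere), and $e_{ij}=1-r_i^{T}r_j=\frac12\|r_i-r_j\|^2$. A total error function is a function of the form $V(E)=\frac12\beta^{T}E\beta=\frac12\sum_{i,j}\beta_i\beta_j e_{ij}$ with $\beta$ a positive vector. *)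

theory Defs
  imports "HOL-Analysis.Analysis"
begin

section \<open>Weighted digraphs and directed spanning trees\<close>

text \<open>
  The node set \<open>{1, \<dots>, m}\<close> is the finite type \<open>'m\<close>. A pair \<open>(j, i)\<close> in the edge relation is
  an edge from \<open>j\<close> to \<open>i\<close>, and its weight is the entry in row \<open>i\<close> and column \<open>j\<close>. Self-loops
  are not excluded.
\<close>

definition weighted_digraph :: "('m::finite \<times> 'm) set \<Rightarrow> real ^ 'm ^ 'm \<Rightarrow> bool" where
  "weighted_digraph \<E> A \<longleftrightarrow>
     (\<forall>i j. ((j, i) \<in> \<E> \<longrightarrow> A $ i $ j > 0) \<and> ((j, i) \<notin> \<E> \<longrightarrow> A $ i $ j = 0))"

definition root_node :: "('m \<times> 'm) set \<Rightarrow> 'm \<Rightarrow> bool" where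
  "root_node \<E> v \<longleftrightarrow> (\<forall>i. i \<noteq> v \<longrightarrow> (v, i) \<in> \<E>\<^sup>+)"

definition directed_tree :: "('m \<times> 'm) set \<Rightarrow> 'm \<Rightarrow> bool" where
  "directed_tree T v \<longleftrightarrow>
     root_node T v \<and> (\<forall>j. (j, v) \<notin> T) \<and> (\<forall>i. i \<noteq> v \<longrightarrow> (\<exists>!j. (j, i) \<in> T))"

text \<open>
  A root reaches every node of the type, so a directed tree on \<open>'m\<close> is automatically spanning.
\<close>

definition has_spanning_tree :: "('m \<times> 'm) set \<Rightarrow> bool" where
  "has_spanning_tree \<E> \<longleftrightarrow> (\<exists>T v. T \<subseteq> \<E> \<and> directed_tree T v)"

lemma has_spanning_tree_iff_root_node: "has_spanning_tree \<E> \<longleftrightarrow> (\<exists>v. root_node \<E> v)"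
proof
  assume "has_spanning_tree \<E>"
  then show "\<exists>v. root_node \<E> v"
    unfolding has_spanning_tree_def directed_tree_def root_node_def
    by (meson trancl_mono)
next
  assume "\<exists>v. root_node \<E> v"
  then obtain v where v: "root_node \<E> v" ..
  define d where "d i = (LEAST n. (v, i) \<in> \<E> ^^ n)" for i
  have d: "(v, i) \<in> \<E> ^^ d i" for i
  proof -
    have "(v, i) \<in> \<E>\<^sup>*"
      using v by (cases "i = v") (auto simp: root_node_def trancl_into_rtrancl)
    then show ?thesis
      unfolding d_def by (metis LeastI rtrancl_power)
  qed
  have "\<exists>j. (j, i) \<in> \<E> \<and> d j < d i" if "i \<noteq> v" for i
  proof -
    from d[of i] that obtain n where n: "d i = Suc n"
      by (cases "d i") auto
    then obtain j where j: "(v, j) \<in> \<E> ^^ n" "(j, i) \<in> \<E>"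
      using d[of i] by auto
    from j(1) have "d j \<le> n"
      unfolding d_def by (rule Least_le)
    with n j show ?thesis by auto
  qed
  then obtain p where p: "(p i, i) \<in> \<E>" "d (p i) < d i" if "i \<noteq> v" for i
    by metis
  define T where "T = {(p i, i) | i. i \<noteq> v}"
  have "(v, i) \<in> T\<^sup>*" for i
  proof (induction "d i" arbitrary: i rule: less_induct)
    case less
    show ?case
    proof (cases "i = v")
      case False
      then have "(v, p i) \<in> T\<^sup>*" "(p i, i) \<in> T"
        using less p T_def by auto
      then show ?thesis by auto
    qed simp
  qed
  then have "root_node T v"
    by (metis root_node_def rtranclD)
  then have "directed_tree T v"
    by (auto simp: directed_tree_def T_def)
  moreover have "T \<subseteq> \<E>"
    using p by (auto simp: T_def)
  ultimately show "has_spanning_tree \<E>"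
    by (auto simp: has_spanning_tree_def)
qed

section \<open>The high-dimensional Kuramoto model\<close>

text \<open>
  A solution lives on an arbitrary nondegenerate interval \<open>I\<close>; at an endpoint belonging to \<open>I\<close>
  the derivative is one-sided.
\<close>

definition kuramoto_solution ::
    "real \<Rightarrow> real ^ 'm ^ 'm::finite \<Rightarrow> real set \<Rightarrow> (real \<Rightarrow> real ^ 'n ^ 'm) \<Rightarrow> bool" where
  "kuramoto_solution k A I r \<longleftrightarrow>
     is_interval I \<and> interior I \<noteq> {} \<and>
     (\<forall>t\<in>I. \<forall>i.
        norm (r t $ i) = 1 \<and>
        ((\<lambda>s. r s $ i) has_vector_derivative
           k *\<^sub>R (\<Sum>j\<in>UNIV. A $ i $ j *\<^sub>R (r t $ j - (r t $ i \<bullet> r t $ j) *\<^sub>R r t $ i)))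
          (at t within I))"

definition error_matrix :: "real ^ 'n ^ 'm \<Rightarrow> real ^ 'm ^ 'm" where
  "error_matrix x = (\<chi> i j. 1 - x $ i \<bullet> x $ j)"

definition total_error :: "real ^ 'm \<Rightarrow> real ^ 'm ^ 'm::finite \<Rightarrow> real" where
  "total_error \<beta> M = 1 / 2 * (\<beta> \<bullet> (M *v \<beta>))"

end

theory Submission
  imports Defs
begin

text \<open>
  On the sphere \<open>e\<^sub>i\<^sub>j = \<parallel>r\<^sub>i - r\<^sub>j\<parallel>\<^sup>2 / 2\<close>, so the errors form a metric up to a factor 2 in the triangle
  inequality; this is the only geometry that the decay estimate uses. Differentiating \<open>V\<close> along the
  flow gives exactly \<open>- k (F - C)\<close>, where \<open>F\<close> (below: \<open>decay_rate\<close>) is the sum of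
  \<open>\<beta>\<^sub>i \<beta>\<^sub>p a\<^sub>i\<^sub>j (e\<^sub>i\<^sub>j + e\<^sub>p\<^sub>i - e\<^sub>p\<^sub>j)\<close>, linear in the errors, and \<open>C\<close> is quadratic in them. Near \<open>E = 0\<close> the
  term \<open>C\<close> is absorbed by any bound \<open>F \<ge> c \<Sum> e\<^sub>i\<^sub>j\<close> with \<open>c > 0\<close>, and \<open>V\<close> is at most a multiple of
  \<open>\<Sum> e\<^sub>i\<^sub>j\<close>. Everything therefore rests on a choice of \<open>\<beta>\<close> for which \<open>F\<close> has such a bound.

  Summation by parts (\<open>decay_rate_eq\<close>) writes \<open>F\<close> as \<open>(\<Sum> \<beta>\<^sub>p) \<Sum> \<beta>\<^sub>i a\<^sub>i\<^sub>j e\<^sub>i\<^sub>j\<close> plus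
  \<open>\<Sum> \<beta>\<^sub>p g\<^sub>i e\<^sub>p\<^sub>i\<close>, where \<open>g\<close> is the row vector \<open>\<beta>\<close> times the graph Laplacian. The first part is
  nonnegative and, along directed paths, controls the distances from the root \<open>v\<close>. If \<open>\<beta>\<close> were a
  left null vector of the Laplacian the second part would vanish, but such a vector, say \<open>w\<close>, is zero
  at all nodes that are not roots. So take \<open>\<beta> = w + \<epsilon> u\<close>, where \<open>u > 0\<close> is a left null vector for the
  strongly connected graph obtained by adding an edge of weight 1 from each node to \<open>v\<close>. With
  respect to the original graph, \<open>u\<close> times the Laplacian is negative at most at \<open>v\<close>. The harmful part of
  the second sum is thus
  \<open>- \<epsilon> H \<Sum> w\<^sub>p e\<^sub>p\<^sub>v - \<epsilon>\<^sup>2 H \<Sum> u\<^sub>p e\<^sub>p\<^sub>v\<close> for a constant \<open>H\<close>; its two terms are of order \<open>\<epsilon>\<close> times the energies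
  \<open>\<Sum> w\<^sub>i a\<^sub>i\<^sub>j e\<^sub>i\<^sub>j\<close> and \<open>\<epsilon> \<Sum> u\<^sub>i a\<^sub>i\<^sub>j e\<^sub>i\<^sub>j\<close> that make up the first part, so a small \<open>\<epsilon>\<close> suffices
  (\<open>exists_weights_decay_rate_ge\<close>).
\<close>

section \<open>Left null vectors of the graph Laplacian\<close>

text \<open>
  Entry \<open>i\<close> of the row vector \<open>w\<close> times the Laplacian. A self-loop contributes equally to both sums,
  so it cancels.
\<close>

definition defect :: "('m::finite \<Rightarrow> 'm \<Rightarrow> real) \<Rightarrow> ('m \<Rightarrow> real) \<Rightarrow> 'm \<Rightarrow> real" where
  "defect a w i = w i * (\<Sum>j\<in>UNIV. a i j) - (\<Sum>j\<in>UNIV. w j * a j i)"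

text \<open>
  The rows of the Laplacian sum to zero, so it is singular and has a left null vector \<open>z\<close>. Taking
  absolute values makes every entry of the defect nonpositive by the triangle inequality, while the
  entries of a defect always sum to zero; hence \<open>\<bar>z\<bar>\<close> is again a null vector.
\<close>
lemma nonneg_null_weights:
  fixes a :: "'m::finite \<Rightarrow> 'm \<Rightarrow> real"
  assumes a: "\<And>i j. a i j \<ge> 0"
  shows "\<exists>w. (\<forall>i. w i \<ge> 0) \<and> (\<exists>i. w i > 0) \<and> (\<forall>i. defect a w i = 0)"
proof -
  define L :: "real^'m^'m" where
    "L = (\<chi> i j. (if i = j then (\<Sum>l\<in>UNIV. a i l) else 0) - a i j)"
  have "L *v 1 = 0"
    by (simp add: L_def vec_eq_iff matrix_vector_mult_def sum_subtractf)
  then have "\<not> invertible L"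
    by (metis invertible_left_inverse matrix_left_invertible_ker one_neq_zero)
  then have "\<not> invertible (transpose L)"
    by (simp add: invertible_det_nz)
  then obtain z where z: "transpose L *v z = 0" "z \<noteq> 0"
    by (metis invertible_left_inverse matrix_left_invertible_ker)
  have bal: "z $ i * (\<Sum>j\<in>UNIV. a i j) = (\<Sum>j\<in>UNIV. z $ j * a j i)" for i
  proof -
    have "(\<Sum>j\<in>UNIV. ((if j = i then (\<Sum>l\<in>UNIV. a j l) else 0) - a j i) * z $ j) = 0"
      using z(1) by (simp add: vec_eq_iff matrix_vector_mult_def transpose_def L_def)
    then have "(\<Sum>j\<in>UNIV. (if j = i then z $ j * (\<Sum>l\<in>UNIV. a j l) else 0) - z $ j * a j i) = 0"
      by (rule trans[rotated]) (auto intro!: sum.cong simp: algebra_simps)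
    then show ?thesis
      by (simp add: sum_subtractf)
  qed
  define w where "w i = \<bar>z $ i\<bar>" for i
  have le: "w i * (\<Sum>j\<in>UNIV. a i j) \<le> (\<Sum>j\<in>UNIV. w j * a j i)" for i
  proof -
    have "w i * (\<Sum>j\<in>UNIV. a i j) = \<bar>\<Sum>j\<in>UNIV. z $ j * a j i\<bar>"
      by (simp add: w_def flip: bal) (simp add: abs_mult a sum_nonneg)
    also have "\<dots> \<le> (\<Sum>j\<in>UNIV. w j * a j i)"
      by (rule order.trans[OF sum_abs]) (simp add: w_def abs_mult a)
    finally show ?thesis .
  qed
  have nonpos: "defect a w i \<le> 0" for i
    using le[of i] by (simp add: defect_def)
  have "(\<Sum>i\<in>UNIV. \<Sum>j\<in>UNIV. w j * a j i) = (\<Sum>i\<in>UNIV. w i * (\<Sum>j\<in>UNIV. a i j))"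
    by (subst sum.swap) (simp add: sum_distrib_left)
  then have "(\<Sum>i\<in>UNIV. defect a w i) = 0"
    by (simp add: defect_def sum_subtractf)
  then have "(\<Sum>i\<in>UNIV. - defect a w i) = 0"
    by (simp add: sum_negf)
  then have "\<forall>i. defect a w i = 0"
    using nonpos by (subst (asm) sum_nonneg_eq_0_iff) auto
  moreover have "\<exists>i. w i > 0"
    using z(2) by (auto simp: w_def vec_eq_iff)
  ultimately show ?thesis
    by (intro exI[of _ w]) (auto simp: w_def)
qed

text \<open>
  The support of a nonnegative left null vector is closed under predecessors. This shows positivity
  in the strongly connected case, and in general keeps paths that end in the support inside it.
\<close>
lemma null_weights_pos_pred:
  assumes a: "\<And>i j. a i j \<ge> 0" and w: "\<And>i. w i \<ge> 0" "defect a w i = 0"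
    and edge: "a j i > 0" "w j > 0"
  shows "w i > 0"
proof -
  have "0 < w j * a j i" using edge by simp
  also have "\<dots> \<le> (\<Sum>j\<in>UNIV. w j * a j i)"
    by (rule member_le_sum) (auto simp: a w)
  also have "\<dots> = w i * (\<Sum>j\<in>UNIV. a i j)"
    using w(2) by (simp add: defect_def)
  finally show ?thesis
    using w(1)[of i] by (cases "w i = 0") auto
qed

lemma null_weights_pos_ancestor:
  assumes a: "\<And>i j. a i j \<ge> 0" and w: "\<And>i. w i \<ge> 0" "\<And>i. defect a w i = 0"
    and path: "(q, p) \<in> {(j, i). a i j > 0}\<^sup>*" and p: "w p > 0"
  shows "w q > 0"
  using path p
  by (induction rule: converse_rtrancl_induct)
    (auto intro: null_weights_pos_pred[of a w] a w)

section \<open>Relaxed metrics and the energy of edges\<close>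

definition near_metric :: "('m \<Rightarrow> 'm \<Rightarrow> real) \<Rightarrow> bool" where
  "near_metric e \<longleftrightarrow> (\<forall>i. e i i = 0) \<and> (\<forall>i j. e i j = e j i) \<and>
     (\<forall>i j l. e i j \<le> 2 * (e i l + e l j))"

lemma near_metric_nonneg: "near_metric e \<Longrightarrow> e i j \<ge> 0"
  unfolding near_metric_def by (smt (verit, best))

definition edge_energy ::
    "('m::finite \<Rightarrow> 'm \<Rightarrow> real) \<Rightarrow> ('m \<Rightarrow> real) \<Rightarrow> ('m \<Rightarrow> 'm \<Rightarrow> real) \<Rightarrow> real" where
  "edge_energy a w e = (\<Sum>i\<in>UNIV. \<Sum>j\<in>UNIV. w i * a i j * e i j)"

lemma edge_energy_nonneg:
  assumes "\<And>i j. a i j \<ge> 0" "\<And>i. w i \<ge> 0" "near_metric e"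
  shows "edge_energy a w e \<ge> 0"
  unfolding edge_energy_def by (intro sum_nonneg mult_nonneg_nonneg assms near_metric_nonneg)

lemma entry_le_double_sum:
  fixes f :: "'m::finite \<Rightarrow> 'm \<Rightarrow> real"
  assumes "\<And>i j. f i j \<ge> 0"
  shows "f i j \<le> (\<Sum>i\<in>UNIV. \<Sum>j\<in>UNIV. f i j)"
proof -
  have "f i j \<le> (\<Sum>j\<in>UNIV. f i j)"
    by (rule member_le_sum) (auto simp: assms)
  also have "\<dots> \<le> (\<Sum>i\<in>UNIV. \<Sum>j\<in>UNIV. f i j)"
    by (rule member_le_sum[of i _ "\<lambda>i. \<Sum>j\<in>UNIV. f i j"]) (auto intro: sum_nonneg assms)
  finally show ?thesis .
qed

lemma edge_le_edge_energy:
  assumes "\<And>i j. a i j \<ge> 0" "\<And>i. w i \<ge> 0" "near_metric e"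
  shows "w i * a i j * e i j \<le> edge_energy a w e"
  unfolding edge_energy_def
  by (rule entry_le_double_sum[of "\<lambda>i j. w i * a i j * e i j"])
    (intro mult_nonneg_nonneg assms near_metric_nonneg)

text \<open>
  The factor 2 of the relaxed triangle inequality compounds along the path, but the resulting
  constant depends on the weighted graph only, not on the relaxed metric.
\<close>
lemma path_le_edge_energy:
  fixes a :: "'m::finite \<Rightarrow> 'm \<Rightarrow> real"
  assumes a: "\<And>i j. a i j \<ge> 0" and w: "\<And>i. w i \<ge> 0"
    and path: "(v, p) \<in> {(j, i). w i * a i j > 0}\<^sup>*"
  shows "\<exists>K\<ge>0. \<forall>e. near_metric e \<longrightarrow> e v p \<le> K * edge_energy a w e"
  using path
proof (induction rule: rtrancl_induct)
  case base
  show ?case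
    by (intro exI[of _ 0]) (simp add: near_metric_def)
next
  case (step q p)
  then obtain K where K: "K \<ge> 0" "\<And>e. near_metric e \<Longrightarrow> e v q \<le> K * edge_energy a w e"
    by blast
  from step have pos: "w p * a p q > 0" by simp
  have "e v p \<le> (2 * (K + 1 / (w p * a p q))) * edge_energy a w e" if e: "near_metric e" for e
  proof -
    have "e v p \<le> 2 * (e v q + e p q)"
      using e unfolding near_metric_def by metis
    moreover have "e p q \<le> 1 / (w p * a p q) * edge_energy a w e"
      using edge_le_edge_energy[where a=a and w=w and e=e and i=p and j=q, OF a w e] pos by (simp add: field_simps)
    ultimately show ?thesis
      using K(2)[OF e] by (simp add: algebra_simps)
  qed
  then show ?case
    using K(1) pos by (intro exI[of _ "2 * (K + 1 / (w p * a p q))"]) auto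
qed

section \<open>Weights with a strictly positive decay rate\<close>

text \<open>
  The part of \<open>- V' / k\<close> that is linear in the errors.
\<close>
definition decay_rate ::
    "('m::finite \<Rightarrow> 'm \<Rightarrow> real) \<Rightarrow> ('m \<Rightarrow> real) \<Rightarrow> ('m \<Rightarrow> 'm \<Rightarrow> real) \<Rightarrow> real" where
  "decay_rate a \<beta> e =
     (\<Sum>i\<in>UNIV. \<Sum>j\<in>UNIV. \<Sum>p\<in>UNIV. \<beta> i * \<beta> p * a i j * (e i j + e p i - e p j))"

text \<open>
  Collecting the coefficient of each \<open>e p i\<close> in the last two terms of the decay rate turns the
  indefinite differences into the defect of the weights.
\<close>
lemma decay_rate_eq:
  "decay_rate a \<beta> e = (\<Sum>p\<in>UNIV. \<beta> p) * edge_energy a \<beta> e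
     + (\<Sum>p\<in>UNIV. \<beta> p * (\<Sum>i\<in>UNIV. defect a \<beta> i * e p i))"
proof -
  have "(\<Sum>p\<in>UNIV. \<beta> p) * edge_energy a \<beta> e
      = (\<Sum>i\<in>UNIV. \<Sum>j\<in>UNIV. \<Sum>p\<in>UNIV. \<beta> i * \<beta> p * a i j * e i j)"
    unfolding edge_energy_def
    by (simp add: sum_distrib_left sum_distrib_right mult_ac)
  moreover have "(\<Sum>p\<in>UNIV. \<beta> p * (\<Sum>i\<in>UNIV. defect a \<beta> i * e p i))
      = (\<Sum>p\<in>UNIV. \<Sum>i\<in>UNIV. \<Sum>j\<in>UNIV. \<beta> p * \<beta> i * a i j * e p i)
      - (\<Sum>p\<in>UNIV. \<Sum>i\<in>UNIV. \<Sum>j\<in>UNIV. \<beta> p * \<beta> j * a j i * e p i)"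
    unfolding defect_def
    by (simp add: sum_distrib_left sum_distrib_right mult_ac left_diff_distrib right_diff_distrib
        sum_subtractf)
  moreover have "(\<Sum>p\<in>UNIV. \<Sum>i\<in>UNIV. \<Sum>j\<in>UNIV. \<beta> p * \<beta> i * a i j * e p i)
      = (\<Sum>i\<in>UNIV. \<Sum>j\<in>UNIV. \<Sum>p\<in>UNIV. \<beta> i * \<beta> p * a i j * e p i)"
    by (subst sum.swap, rule sum.cong[OF refl], subst sum.swap) (simp add: mult_ac)
  moreover have "(\<Sum>p\<in>UNIV. \<Sum>i\<in>UNIV. \<Sum>j\<in>UNIV. \<beta> p * \<beta> j * a j i * e p i)
      = (\<Sum>i\<in>UNIV. \<Sum>j\<in>UNIV. \<Sum>p\<in>UNIV. \<beta> i * \<beta> p * a i j * e p j)"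
    by (subst sum.swap, subst (2) sum.swap, subst sum.swap) (simp add: mult_ac)
  ultimately show ?thesis
    unfolding decay_rate_def
    by (simp add: distrib_left right_diff_distrib sum.distrib sum_subtractf)
qed

text \<open>
  Adding an edge of weight 1 from every node to the root \<open>v\<close> makes the graph strongly connected, so its
  nonnegative left null vector \<open>u\<close> is positive. Removing these edges again raises the defect by \<open>u v\<close>
  at every node other than \<open>v\<close>.
\<close>
lemma exists_weights_defect_nonneg:
  fixes a :: "'m::finite \<Rightarrow> 'm \<Rightarrow> real"
  assumes a: "\<And>i j. a i j \<ge> 0" and root: "\<And>p. (v, p) \<in> {(j, i). a i j > 0}\<^sup>*"
  shows "\<exists>u. (\<forall>i. u i > 0) \<and> (\<forall>i. i \<noteq> v \<longrightarrow> defect a u i \<ge> 0)"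
proof -
  define b where "b i j = a i j + (if i = v then 1 else 0)" for i j
  have b: "b i j \<ge> 0" for i j using a by (simp add: b_def)
  obtain u p where u: "\<And>i. u i \<ge> 0" "\<And>i. defect b u i = 0" and p: "u p > 0"
    using nonneg_null_weights[of b] b by blast
  have path: "(q, p) \<in> {(j, i). b i j > 0}\<^sup>*" for q
  proof -
    have "{(j, i). a i j > 0} \<subseteq> {(j, i). b i j > 0}"
      by (auto simp: b_def)
    then have "(v, p) \<in> {(j, i). b i j > 0}\<^sup>*"
      using root[of p] rtrancl_mono by blast
    moreover have "(q, v) \<in> {(j, i). b i j > 0}"
      using a[of v q] by (simp add: b_def)
    ultimately show ?thesis
      by (rule converse_rtrancl_into_rtrancl[rotated])
  qed
  have pos: "u i > 0" for i
    using null_weights_pos_ancestor[OF b u path p] .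
  have "defect a u i \<ge> 0" if "i \<noteq> v" for i
  proof -
    have "defect b u i = defect a u i - u v"
    proof -
      have "(\<Sum>j\<in>UNIV. u j * b j i) = (\<Sum>j\<in>UNIV. u j * a j i + (if j = v then u j else 0))"
        by (rule sum.cong) (auto simp: b_def distrib_left)
      then show ?thesis
        using that by (simp add: defect_def b_def sum.distrib)
    qed
    then show ?thesis using u(2)[of i] u(1)[of v] by simp
  qed
  with pos show ?thesis by blast
qed

text \<open>
  The null vector \<open>w\<close> gives decay only on its own support; the perturbation \<open>\<epsilon> u\<close> reaches the
  remaining nodes. The loss that it causes sits at the root \<open>v\<close> alone, where the energies of \<open>w\<close> and
  \<open>u\<close> control it separately: the loss weighted by \<open>w\<close> has order \<open>\<epsilon>\<close> against an energy of order 1,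
  the loss weighted by \<open>u\<close> has order \<open>\<epsilon>\<^sup>2\<close> against an energy of order \<open>\<epsilon>\<close>.
\<close>
lemma exists_weights_decay_rate_ge:
  fixes a :: "'m::finite \<Rightarrow> 'm \<Rightarrow> real"
  assumes a: "\<And>i j. a i j \<ge> 0" and root: "\<And>p. (v, p) \<in> {(j, i). a i j > 0}\<^sup>*"
  shows "\<exists>\<beta> c. (\<forall>i. \<beta> i > 0) \<and> c > 0 \<and>
           (\<forall>e. near_metric e \<longrightarrow> c * (\<Sum>i\<in>UNIV. \<Sum>j\<in>UNIV. e i j) \<le> decay_rate a \<beta> e)"
proof -
  obtain w q where w: "\<And>i. w i \<ge> 0" "\<And>i. defect a w i = 0" and q: "w q > 0"
    using nonneg_null_weights[of a] a by blast
  obtain u where u: "\<And>i. u i > 0" "\<And>i. i \<noteq> v \<Longrightarrow> defect a u i \<ge> 0"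
    using exists_weights_defect_nonneg[of a v] a root by blast
  have u0: "u i \<ge> 0" for i using u(1)[of i] by simp
  have path_u: "(v, p) \<in> {(j, i). u i * a i j > 0}\<^sup>*" for p
  proof -
    have "u i * a i j > 0 \<longleftrightarrow> a i j > 0" for i j
      using u(1)[of i] by (simp add: zero_less_mult_iff)
    then show ?thesis using root by simp
  qed
  have path_w: "(v, p) \<in> {(j, i). w i * a i j > 0}\<^sup>*" if "w p > 0" for p
    using root[of p] that
  proof (induction rule: rtrancl_induct)
    case (step y z)
    then have "w y > 0"
      by (intro null_weights_pos_pred[of a w y z]) (auto simp: a w)
    with step show ?case
      by (auto intro: rtrancl_into_rtrancl)
  qed simp
  have "\<forall>p. \<exists>K\<ge>0. \<forall>e. near_metric e \<longrightarrow> e v p \<le> K * edge_energy a u e"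
    using path_le_edge_energy[of a u v] a u0 path_u by blast
  then obtain Ku where Ku: "\<And>p. Ku p \<ge> 0"
      "\<And>p e. near_metric e \<Longrightarrow> e v p \<le> Ku p * edge_energy a u e"
    by metis
  have "\<forall>p. \<exists>K\<ge>0. w p > 0 \<longrightarrow> (\<forall>e. near_metric e \<longrightarrow> e v p \<le> K * edge_energy a w e)"
    using path_le_edge_energy[of a w v] a w path_w by blast
  then obtain Kw where Kw: "\<And>p. Kw p \<ge> 0"
      "\<And>p e. w p > 0 \<Longrightarrow> near_metric e \<Longrightarrow> e v p \<le> Kw p * edge_energy a w e"
    by metis
  define H W Cu Cw where "H = \<bar>defect a u v\<bar>" and "W = (\<Sum>p\<in>UNIV. w p)"
    and "Cu = (\<Sum>p\<in>UNIV. u p * Ku p)" and "Cw = (\<Sum>p\<in>UNIV. w p * Kw p)"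
  have W: "W > 0"
    unfolding W_def using w(1) q by (intro sum_pos2[of UNIV q]) auto
  have H: "H \<ge> 0" and Cu: "Cu \<ge> 0" and Cw: "Cw \<ge> 0"
    by (auto simp: H_def Cu_def Cw_def intro!: sum_nonneg mult_nonneg_nonneg u0 w Ku Kw)
  (* chosen so that the loss uses up at most the whole energy of w and half of that of u *)
  define \<epsilon> where "\<epsilon> = W / (2 * H * (Cu + Cw) + 1)"
  have den: "2 * H * (Cu + Cw) + 1 > 0"
    using H Cu Cw by (smt (verit) mult_nonneg_nonneg)
  have \<epsilon>: "\<epsilon> > 0" using W den by (simp add: \<epsilon>_def)
  have \<epsilon>_bound: "2 * \<epsilon> * H * Cu + 2 * \<epsilon> * H * Cw \<le> W"
  proof -
    have "\<epsilon> * (2 * H * (Cu + Cw) + 1) = W"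
      using den by (simp add: \<epsilon>_def)
    then show ?thesis using \<epsilon> by (simp add: algebra_simps)
  qed
  have "0 \<le> 2 * \<epsilon> * H * Cu" "0 \<le> 2 * \<epsilon> * H * Cw"
    using \<epsilon> H Cu Cw by auto
  with \<epsilon>_bound have \<epsilon>u: "\<epsilon> * H * Cu \<le> W / 2" and \<epsilon>w: "\<epsilon> * H * Cw \<le> W"
    by linarith+
  define \<beta> where "\<beta> i = w i + \<epsilon> * u i" for i
  have \<beta>: "\<beta> i > 0" for i
    using w(1)[of i] u(1)[of i] \<epsilon> by (simp add: \<beta>_def add_nonneg_pos)
  have defect_\<beta>: "defect a \<beta> i = \<epsilon> * defect a u i" for i
  proof -
    have "defect a \<beta> i = defect a w i + \<epsilon> * defect a u i"
      by (simp add: defect_def \<beta>_def sum.distrib sum_distrib_left algebra_simps)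
    then show ?thesis by (simp add: w)
  qed
  define N where "N = (\<Sum>i\<in>(UNIV :: 'm set). \<Sum>j\<in>(UNIV :: 'm set). 2 * (Ku i + Ku j)) + 1"
  have N: "N > 0"
    unfolding N_def by (intro add_nonneg_pos sum_nonneg) (auto simp: Ku)
  have "\<epsilon> * W / (2 * N) * (\<Sum>i\<in>UNIV. \<Sum>j\<in>UNIV. e i j) \<le> decay_rate a \<beta> e"
    if e: "near_metric e" for e
  proof -
    let ?Eu = "edge_energy a u e" and ?Ew = "edge_energy a w e"
    note nn = near_metric_nonneg[OF e]
    have Eu: "?Eu \<ge> 0" and Ew: "?Ew \<ge> 0"
      using edge_energy_nonneg[of a] a u0 w e by blast+
    have sym: "e i j = e j i" for i j
      using e by (auto simp: near_metric_def)
    have sum_u: "(\<Sum>p\<in>UNIV. u p * e p v) \<le> Cu * ?Eu"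
      unfolding Cu_def sum_distrib_right
      using Ku(2)[OF e] u0 by (intro sum_mono) (simp add: sym[of _ v] mult_left_mono mult.assoc)
    have sum_w: "(\<Sum>p\<in>UNIV. w p * e p v) \<le> Cw * ?Ew"
      unfolding Cw_def sum_distrib_right
    proof (rule sum_mono)
      fix p
      show "w p * e p v \<le> w p * Kw p * ?Ew"
        using Kw(2)[of p e] e w(1)[of p]
        by (cases "w p = 0") (simp_all add: sym[of _ v] mult_left_mono mult.assoc)
    qed
    (* only the entry at v of the defect can be negative *)
    have "- (\<epsilon> * H) * e p v \<le> (\<Sum>i\<in>UNIV. defect a \<beta> i * e p i)" for p
    proof -
      have "(\<Sum>i\<in>UNIV. defect a \<beta> i * e p i)
          = defect a \<beta> v * e p v + (\<Sum>i\<in>UNIV - {v}. defect a \<beta> i * e p i)"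
        by (simp add: sum.remove[of UNIV v])
      moreover have "(\<Sum>i\<in>UNIV - {v}. defect a \<beta> i * e p i) \<ge> 0"
        using u(2) \<epsilon> nn by (intro sum_nonneg) (simp add: defect_\<beta>)
      moreover have "- (\<epsilon> * H) * e p v \<le> defect a \<beta> v * e p v"
      proof (rule mult_right_mono[OF _ nn])
        have "\<epsilon> * - H \<le> \<epsilon> * defect a u v"
          using \<epsilon> by (intro mult_left_mono) (auto simp: H_def)
        then show "- (\<epsilon> * H) \<le> defect a \<beta> v"
          by (simp add: defect_\<beta>)
      qed
      ultimately show ?thesis by linarith
    qed
    then have "(\<Sum>p\<in>UNIV. \<beta> p * (- (\<epsilon> * H) * e p v))
        \<le> (\<Sum>p\<in>UNIV. \<beta> p * (\<Sum>i\<in>UNIV. defect a \<beta> i * e p i))"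
      using \<beta> by (intro sum_mono mult_left_mono) (auto simp: order.strict_implies_order)
    moreover have "(\<Sum>p\<in>UNIV. \<beta> p * (- (\<epsilon> * H) * e p v))
        = - (\<epsilon> * H) * ((\<Sum>p\<in>UNIV. w p * e p v) + \<epsilon> * (\<Sum>p\<in>UNIV. u p * e p v))"
      unfolding sum_distrib_left sum.distrib[symmetric]
      by (intro sum.cong) (simp_all add: \<beta>_def algebra_simps)
    moreover have "\<epsilon> * H * ((\<Sum>p\<in>UNIV. w p * e p v) + \<epsilon> * (\<Sum>p\<in>UNIV. u p * e p v))
        \<le> \<epsilon> * H * (Cw * ?Ew + \<epsilon> * (Cu * ?Eu))"
      using sum_u sum_w \<epsilon> H by (intro mult_left_mono add_mono) auto
    moreover have "\<epsilon> * H * (Cw * ?Ew + \<epsilon> * (Cu * ?Eu)) \<le> W * ?Ew + \<epsilon> * W / 2 * ?Eu"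
    proof -
      have "(\<epsilon> * H * Cw) * ?Ew \<le> W * ?Ew"
        using \<epsilon>w Ew by (rule mult_right_mono)
      moreover have "(\<epsilon> * H * Cu) * (\<epsilon> * ?Eu) \<le> W / 2 * (\<epsilon> * ?Eu)"
        using \<epsilon>u Eu \<epsilon> by (intro mult_right_mono) simp_all
      moreover have "\<epsilon> * H * (Cw * ?Ew + \<epsilon> * (Cu * ?Eu))
          = (\<epsilon> * H * Cw) * ?Ew + (\<epsilon> * H * Cu) * (\<epsilon> * ?Eu)"
        by (simp add: algebra_simps)
      moreover have "\<epsilon> * W / 2 * ?Eu = W / 2 * (\<epsilon> * ?Eu)"
        by simp
      ultimately show ?thesis by linarith
    qed
    moreover have "W * (?Ew + \<epsilon> * ?Eu) \<le> (\<Sum>p\<in>UNIV. \<beta> p) * edge_energy a \<beta> e"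
    proof -
      have "edge_energy a \<beta> e = ?Ew + \<epsilon> * ?Eu"
        by (simp add: edge_energy_def \<beta>_def sum.distrib sum_distrib_left algebra_simps)
      moreover have "W \<le> (\<Sum>p\<in>UNIV. \<beta> p)"
        unfolding W_def using u0 \<epsilon> by (intro sum_mono) (simp add: \<beta>_def)
      ultimately show ?thesis
        using Eu Ew \<epsilon> by (simp add: mult_right_mono)
    qed
    ultimately have rate: "\<epsilon> * W / 2 * ?Eu \<le> decay_rate a \<beta> e"
      unfolding decay_rate_eq by (simp add: algebra_simps)
    have "(\<Sum>i\<in>UNIV. \<Sum>j\<in>UNIV. e i j) \<le> (\<Sum>i\<in>UNIV. \<Sum>j\<in>UNIV. 2 * (Ku i + Ku j) * ?Eu)"
    proof (intro sum_mono)
      fix i j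
      have "e i j \<le> 2 * (e i v + e v j)"
        using e unfolding near_metric_def by blast
      then have "e i j \<le> 2 * (e v i + e v j)"
        by (simp only: sym[of i v])
      also have "\<dots> \<le> 2 * (Ku i * ?Eu + Ku j * ?Eu)"
        by (intro mult_left_mono add_mono Ku(2)[OF e]) simp
      also have "\<dots> = 2 * (Ku i + Ku j) * ?Eu"
        by (simp add: algebra_simps)
      finally show "e i j \<le> 2 * (Ku i + Ku j) * ?Eu" .
    qed
    also have "\<dots> \<le> N * ?Eu"
      using Eu unfolding N_def by (simp add: sum_distrib_right distrib_right)
    finally have "\<epsilon> * W / (2 * N) * (\<Sum>i\<in>UNIV. \<Sum>j\<in>UNIV. e i j) \<le> \<epsilon> * W / (2 * N) * (N * ?Eu)"
      using \<epsilon> W N by (intro mult_left_mono) auto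
    also have "\<dots> = \<epsilon> * W / 2 * ?Eu" using N by simp
    finally show ?thesis using rate by linarith
  qed
  moreover have "\<epsilon> * W / (2 * N) > 0" using \<epsilon> W N by simp
  ultimately show ?thesis using \<beta> by blast
qed

section \<open>The error function along solutions\<close>

lemma near_metric_error_matrix:
  fixes x :: "real ^ 'n ^ 'm"
  assumes "\<And>i. norm (x $ i) = 1"
  shows "near_metric (\<lambda>i j. error_matrix x $ i $ j)"
proof -
  have e: "error_matrix x $ i $ j = (norm (x $ i - x $ j))\<^sup>2 / 2" for i j
    using assms by (simp add: error_matrix_def power2_norm_eq_inner inner_diff inner_commute
        norm_eq_1)
  have "(norm (a - b))\<^sup>2 / 2 \<le> 2 * ((norm (a - c))\<^sup>2 / 2 + (norm (c - b))\<^sup>2 / 2)"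
    for a b c :: "real ^ 'n"
  proof -
    have "norm (a - b) \<le> norm (a - c) + norm (c - b)"
      using norm_triangle_ineq[of "a - c" "c - b"] by simp
    then have "(norm (a - b))\<^sup>2 \<le> (norm (a - c) + norm (c - b))\<^sup>2"
      by (intro power_mono) auto
    also have "\<dots> \<le> 2 * ((norm (a - c))\<^sup>2 + (norm (c - b))\<^sup>2)"
      using sum_squares_bound[of "norm (a - c)" "norm (c - b)"]
      by (simp add: power2_sum)
    finally show ?thesis by simp
  qed
  then show ?thesis
    unfolding near_metric_def e by (simp add: norm_minus_commute)
qed

lemma total_error_eq_sum:
  "total_error \<beta> M = 1 / 2 * (\<Sum>i\<in>UNIV. \<Sum>j\<in>UNIV. \<beta> $ i * \<beta> $ j * M $ i $ j)"
  by (simp add: total_error_def inner_vec_def matrix_vector_mult_def sum_distrib_left mult_ac)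

text \<open>
  Since the error matrix is symmetric, both factors of \<open>r\<^sub>i \<bullet> r\<^sub>p\<close> contribute the same to the
  derivative. Writing all inner products as \<open>1 - e\<close> turns
  \<open>(r\<^sub>j - (r\<^sub>i \<bullet> r\<^sub>j) r\<^sub>i) \<bullet> r\<^sub>p\<close> into \<open>e\<^sub>i\<^sub>j + e\<^sub>p\<^sub>i - e\<^sub>p\<^sub>j - e\<^sub>i\<^sub>j e\<^sub>p\<^sub>i\<close>.
\<close>
lemma total_error_derivative:
  fixes r :: "real \<Rightarrow> real ^ 'n ^ 'm::finite"
  assumes sol: "kuramoto_solution k A I r" and t: "t \<in> I"
  defines "e \<equiv> \<lambda>i j. error_matrix (r t) $ i $ j"
  shows "((\<lambda>s. total_error \<beta> (error_matrix (r s))) has_real_derivative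
           - k * (decay_rate (\<lambda>i j. A $ i $ j) (($) \<beta>) e -
             (\<Sum>i\<in>UNIV. \<Sum>j\<in>UNIV. \<Sum>p\<in>UNIV. \<beta> $ i * \<beta> $ p * A $ i $ j * (e i j * e p i))))
         (at t within I)"
proof -
  define f where "f i = k *\<^sub>R (\<Sum>j\<in>UNIV. A $ i $ j *\<^sub>R (r t $ j - (r t $ i \<bullet> r t $ j) *\<^sub>R r t $ i))" for i
  have d: "((\<lambda>s. r s $ i) has_vector_derivative f i) (at t within I)"
    and unit: "norm (r t $ i) = 1" for i
    using sol t by (auto simp: kuramoto_solution_def f_def)
  have "((\<lambda>s. r s $ i \<bullet> r s $ p) has_real_derivative (r t $ i \<bullet> f p + f i \<bullet> r t $ p)) (at t within I)"
    for i p
    unfolding has_real_derivative_iff_has_vector_derivative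
    by (rule bounded_bilinear.has_vector_derivative[OF bounded_bilinear_inner d d])
  then have "((\<lambda>s. total_error \<beta> (error_matrix (r s))) has_real_derivative
      1 / 2 * (\<Sum>i\<in>UNIV. \<Sum>p\<in>UNIV. \<beta> $ i * \<beta> $ p * (0 - (r t $ i \<bullet> f p + f i \<bullet> r t $ p))))
      (at t within I)"
    unfolding total_error_eq_sum error_matrix_def vec_lambda_beta
    by (intro DERIV_cmult DERIV_sum DERIV_diff DERIV_const) auto
  moreover have "1 / 2 * (\<Sum>i\<in>UNIV. \<Sum>p\<in>UNIV. \<beta> $ i * \<beta> $ p * (0 - (r t $ i \<bullet> f p + f i \<bullet> r t $ p)))
      = - (\<Sum>i\<in>UNIV. \<Sum>p\<in>UNIV. \<beta> $ i * \<beta> $ p * (f i \<bullet> r t $ p))"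
  proof -
    have "(\<Sum>i\<in>UNIV. \<Sum>p\<in>UNIV. \<beta> $ i * \<beta> $ p * (r t $ i \<bullet> f p))
        = (\<Sum>i\<in>UNIV. \<Sum>p\<in>UNIV. \<beta> $ i * \<beta> $ p * (f i \<bullet> r t $ p))"
      by (subst sum.swap) (simp add: inner_commute mult_ac)
    then show ?thesis
      by (simp add: distrib_left right_diff_distrib sum.distrib sum_subtractf sum_negf)
  qed
  moreover have "(\<Sum>i\<in>UNIV. \<Sum>p\<in>UNIV. \<beta> $ i * \<beta> $ p * (f i \<bullet> r t $ p))
      = k * (decay_rate (\<lambda>i j. A $ i $ j) (($) \<beta>) e -
             (\<Sum>i\<in>UNIV. \<Sum>j\<in>UNIV. \<Sum>p\<in>UNIV. \<beta> $ i * \<beta> $ p * A $ i $ j * (e i j * e p i)))"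
  proof -
    have *: "(r t $ j - (r t $ i \<bullet> r t $ j) *\<^sub>R r t $ i) \<bullet> r t $ p
        = e i j + e p i - e p j - e i j * e p i" for i j p
      by (simp add: e_def error_matrix_def inner_diff inner_commute algebra_simps)
    have "(\<Sum>i\<in>UNIV. \<Sum>p\<in>UNIV. \<beta> $ i * \<beta> $ p * (f i \<bullet> r t $ p))
        = (\<Sum>i\<in>UNIV. \<Sum>p\<in>UNIV. \<Sum>j\<in>UNIV.
            k * (\<beta> $ i * \<beta> $ p * A $ i $ j * (e i j + e p i - e p j - e i j * e p i)))"
      unfolding f_def inner_scaleR_left inner_sum_left *
      by (simp add: sum_distrib_left mult_ac)
    also have "\<dots> = (\<Sum>i\<in>UNIV. \<Sum>j\<in>UNIV. \<Sum>p\<in>UNIV.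
            k * (\<beta> $ i * \<beta> $ p * A $ i $ j * (e i j + e p i - e p j - e i j * e p i)))"
      by (rule sum.cong[OF refl], rule sum.swap)
    also have "\<dots> = k * (decay_rate (\<lambda>i j. A $ i $ j) (($) \<beta>) e -
             (\<Sum>i\<in>UNIV. \<Sum>j\<in>UNIV. \<Sum>p\<in>UNIV. \<beta> $ i * \<beta> $ p * A $ i $ j * (e i j * e p i)))"
      unfolding decay_rate_def right_diff_distrib[of _ "e _ _ + e _ _ - e _ _"]
      by (simp add: sum_distrib_left sum_subtractf right_diff_distrib)
    finally show ?thesis .
  qed
  ultimately show ?thesis by simp
qed

theorem theorem3p2:
  fixes k :: real
    and \<E> :: "('m::finite \<times> 'm) set"
    and A :: "real ^ 'm ^ 'm"
  assumes "k > 0"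
    and "weighted_digraph \<E> A"
    and "has_spanning_tree \<E>"
  shows "\<exists>(\<beta> :: real ^ 'm) (U :: (real ^ 'm ^ 'm) set) (c :: real).
           (\<forall>i. \<beta> $ i > 0) \<and> 0 \<in> interior U \<and> c > 0 \<and>
           (\<forall>I (r :: real \<Rightarrow> real ^ 'n ^ 'm).
              kuramoto_solution k A I r \<longrightarrow>
              (\<forall>t\<in>I. error_matrix (r t) \<in> U \<longrightarrow>
                 (\<exists>D. ((\<lambda>s. total_error \<beta> (error_matrix (r s))) has_real_derivative D)
                         (at t within I) \<and>
                      D \<le> - c * total_error \<beta> (error_matrix (r t)))))"
proof -
  define a where "a i j = A $ i $ j" for i j
  have a: "a i j \<ge> 0" for i j
    using assms(2) by (cases "(j, i) \<in> \<E>") (auto simp: weighted_digraph_def a_def less_imp_le)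
  have edges: "{(j, i). a i j > 0} = \<E>"
  proof -
    have "a i j > 0 \<longleftrightarrow> (j, i) \<in> \<E>" for i j
      using assms(2) by (cases "(j, i) \<in> \<E>") (auto simp: weighted_digraph_def a_def)
    then show ?thesis by auto
  qed
  obtain v where "root_node \<E> v"
    using assms(3) unfolding has_spanning_tree_iff_root_node ..
  then have root: "(v, p) \<in> {(j, i). a i j > 0}\<^sup>*" for p
    unfolding edges root_node_def by (metis rtrancl.rtrancl_refl trancl_into_rtrancl)
  obtain b c where b: "\<And>i. b i > 0" and c: "c > 0"
    and rate: "\<And>e. near_metric e \<Longrightarrow> c * (\<Sum>i\<in>UNIV. \<Sum>j\<in>UNIV. e i j) \<le> decay_rate a b e"
    using exists_weights_decay_rate_ge[of a v] a root by blast
  define \<beta> :: "real^'m" where "\<beta> = (\<chi> i. b i)"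
  have b0: "b i \<ge> 0" for i using b[of i] by simp
  (* the summand 1 keeps G positive for a graph without edges *)
  define G where "G = (\<Sum>i\<in>UNIV. \<Sum>j\<in>UNIV. \<Sum>p\<in>UNIV. b i * b p * a i j) + 1"
  define P where "P = (\<Sum>i\<in>UNIV. \<Sum>j\<in>UNIV. b i * b j)"
  have G: "G > 0"
    unfolding G_def by (intro add_nonneg_pos sum_nonneg) (auto simp: a b0)
  have P: "P > 0"
    unfolding P_def using b by (intro sum_pos) auto
  (* radius on which the quadratic term costs at most half of the linear decay *)
  define \<eta> where "\<eta> = c / (2 * G)"
  have \<eta>: "\<eta> > 0" using c G by (simp add: \<eta>_def)
  show ?thesis
  proof (rule exI[of _ \<beta>], rule exI[of _ "ball 0 \<eta>"], rule exI[of _ "k * c / P"],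
      intro conjI allI impI ballI)
    show "\<beta> $ i > 0" for i using b by (simp add: \<beta>_def)
    show "0 \<in> interior (ball 0 \<eta> :: (real^'m^'m) set)"
      using \<eta> by (simp add: interior_open)
    show "k * c / P > 0" using assms(1) c P by simp
    fix I and r :: "real \<Rightarrow> real ^ 'n ^ 'm" and t
    assume sol: "kuramoto_solution k A I r" and t: "t \<in> I"
      and U: "error_matrix (r t) \<in> ball 0 \<eta>"
    define e where "e i j = error_matrix (r t) $ i $ j" for i j
    define S where "S = (\<Sum>i\<in>UNIV. \<Sum>j\<in>UNIV. e i j)"
    define T where "T = (\<Sum>i\<in>UNIV. \<Sum>j\<in>UNIV. \<Sum>p\<in>UNIV. b i * b p * a i j * (e i j * e p i))"
    have e: "near_metric e"
      unfolding e_def using sol t by (intro near_metric_error_matrix) (auto simp: kuramoto_solution_def)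
    note nn = near_metric_nonneg[OF e]
    have e_le_S: "e i j \<le> S" for i j
      unfolding S_def by (rule entry_le_double_sum) (rule nn)
    have S: "S \<ge> 0" using e_le_S[of v v] nn[of v v] by linarith
    have small: "e i j \<le> \<eta>" for i j
    proof -
      have "e i j \<le> norm (error_matrix (r t) $ i)"
        unfolding e_def using component_le_norm_cart[of "error_matrix (r t) $ i" j] by simp
      also have "\<dots> \<le> norm (error_matrix (r t))"
        by (rule Finite_Cartesian_Product.norm_nth_le)
      finally have "e i j \<le> norm (error_matrix (r t))" .
      then show ?thesis using U by simp
    qed
    have "T \<le> (\<Sum>i\<in>UNIV. \<Sum>j\<in>UNIV. \<Sum>p\<in>UNIV. b i * b p * a i j * (S * \<eta>))"
      unfolding T_def
      by (intro sum_mono mult_left_mono[OF mult_mono[OF e_le_S small S nn]] mult_nonneg_nonneg a b0)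
    also have "\<dots> \<le> G * (S * \<eta>)"
      unfolding G_def using S \<eta> by (simp add: sum_distrib_right distrib_right)
    also have "\<dots> = c / 2 * S"
      using G by (simp add: \<eta>_def)
    finally have T: "T \<le> c / 2 * S" .
    have V: "total_error \<beta> (error_matrix (r t)) \<le> P * S / 2"
    proof -
      have "(\<Sum>i\<in>UNIV. \<Sum>j\<in>UNIV. b i * b j * e i j) \<le> (\<Sum>i\<in>UNIV. \<Sum>j\<in>UNIV. b i * b j * S)"
        by (intro sum_mono mult_left_mono e_le_S mult_nonneg_nonneg b0)
      also have "\<dots> = P * S"
        by (simp add: P_def sum_distrib_right)
      finally show ?thesis
        by (simp add: total_error_eq_sum \<beta>_def e_def)
    qed
    have \<beta>b: "($) \<beta> = b" by (simp add: \<beta>_def fun_eq_iff)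
    have "((\<lambda>s. total_error \<beta> (error_matrix (r s))) has_real_derivative
        - k * (decay_rate a b e - T)) (at t within I)"
      using total_error_derivative[OF sol t, of \<beta>]
      unfolding T_def e_def[symmetric] a_def[symmetric] \<beta>b fun_cong[OF \<beta>b] by simp
    moreover have "- k * (decay_rate a b e - T) \<le> - (k * c / P) * total_error \<beta> (error_matrix (r t))"
    proof -
      have "k * c / P * total_error \<beta> (error_matrix (r t)) \<le> k * c / P * (P * S / 2)"
        using V assms(1) c P by (intro mult_left_mono) auto
      also have "\<dots> = k * (c / 2 * S)" using P by simp
      also have "\<dots> \<le> k * (decay_rate a b e - T)"
        using T rate[OF e] assms(1) by (intro mult_left_mono) (auto simp: S_def)
      finally show ?thesis by simp
    qed
    ultimately show "\<exists>D. ((\<lambda>s. total_error \<beta> (error_matrix (r s))) has_real_derivative D)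
        (at t within I) \<and> D \<le> - (k * c / P) * total_error \<beta> (error_matrix (r t))"
      by blast
  qed
qed

end
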